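(* Let $m \geq 2$ be an integer and let $G = Q_{4m} = \langle a, b : a^{2m} = 1,\ b^2 = a^m,\ bab^{-1} = a^{-1} \rangle$ be the dicyclic group of order $4m$. Then $$M_1(\mathcal{CCC}(G)) = \begin{cases} (m-1)(m-2)^2, & \text{when } m \text{ is even} \\ (m-1)(m-2)^2 + 2, & \text{when } m \text{ is odd} \end{cases}$$ and $$M_2(\mathcal{CCC}(G)) = \begin{cases} \frac{(m-1)(m-2)^3}{2}, & \text{when } m \text{ is even} \\ \frac{(m-1)(m-2)^3}{2} + 1, & \text{when } m \text{ is odd.} \end{cases}$$ Further, $\frac{M_2(\mathcal{CCC}(G))}{|e(\mathcal{CCC}(G))|} \geq \frac{M_1(\mathcal{CCC}(G))}{|v(\mathcal{CCC}(G))|}$, with equality when $m = 2$ and $3$.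
   Context: For a finite group $G$ and $x \in G$, $x^G$ denotes the conjugacy class of $x$ in $G$. The commuting conjugacy class graph $\mathcal{CCC}(G)$ is the simple undirected graph whose vertices are the conjugacy classes of non-central elements of $G$, where two distinct vertices $x^G$ and $y^G$ are adjacent if and only if there exist $x' \in x^G$ and $y' \in y^G$ with $x'y' = y'x'$. For a finite simple graph $\Gamma$ with vertex set $v(\Gamma)$ and edge set $e(\Gamma)$, the first and second Zagreb indices are $M_1(\Gamma) = \sum_{v \in v(\Gamma)} \deg(v)^2$ and $M_2(\Gamma) = \sum_{uv \in e(\Gamma)} \deg(u)\deg(v)$. Convention: if $\Gamma$ has no edges (so $M_1(\Gamma)=M_2(\Gamma)=0$), the quotient $M_2(\Gamma)/|e(\Gamma)|$ is read as $0$. *)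

theory Defs
  imports Complex_Main "HOL-Algebra.Group_Action"
begin

section \<open>Groups given by generators and relations\<close>

text \<open>A letter \<open>(x, True)\<close> stands for the generator \<open>x\<close>, and \<open>(x, False)\<close> for its formal
  inverse. A relation \<open>u = v\<close> between words is the pair \<open>(u, v)\<close>. The generating set is the
  whole type \<open>'x\<close>.\<close>

type_synonym 'x word = "('x \<times> bool) list"

inductive word_equiv :: "('x word \<times> 'x word) set \<Rightarrow> 'x word \<Rightarrow> 'x word \<Rightarrow> bool"
  for R :: "('x word \<times> 'x word) set"
where
  refl: "word_equiv R u u"
| sym: "word_equiv R u v \<Longrightarrow> word_equiv R v u"
| trans: "word_equiv R u v \<Longrightarrow> word_equiv R v w \<Longrightarrow> word_equiv R u w"
| append: "word_equiv R u u' \<Longrightarrow> word_equiv R v v' \<Longrightarrow> word_equiv R (u @ v) (u' @ v')"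
| cancel: "word_equiv R [(x, e), (x, \<not> e)] []"
| relation: "(u, v) \<in> R \<Longrightarrow> word_equiv R u v"

definition word_class :: "('x word \<times> 'x word) set \<Rightarrow> 'x word \<Rightarrow> 'x word set" where
  "word_class R u = {v. word_equiv R u v}"

text \<open>The group \<open>\<langle>'x : R\<rangle>\<close>. In the product, all the words \<open>u @ v\<close> lie in a single class, so the
  union is that class; see \<open>word_class_mult\<close> below.\<close>

definition presented_group :: "('x word \<times> 'x word) set \<Rightarrow> 'x word set monoid" where
  "presented_group R =
     \<lparr>carrier = range (word_class R),
      monoid.mult = (\<lambda>U V. \<Union>u\<in>U. \<Union>v\<in>V. word_class R (u @ v)),
      monoid.one = word_class R []\<rparr>"

lemma word_class_eq_iff: "word_class R u = word_class R v \<longleftrightarrow> word_equiv R u v"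
  unfolding word_class_def set_eq_iff mem_Collect_eq
  by (metis word_equiv.refl word_equiv.sym word_equiv.trans)

lemma word_class_mult:
  "word_class R u \<otimes>\<^bsub>presented_group R\<^esub> word_class R v = word_class R (u @ v)"
proof -
  have "word_class R (u' @ v') = word_class R (u @ v)"
    if "u' \<in> word_class R u" "v' \<in> word_class R v" for u' v'
  proof -
    have "word_equiv R u u'" "word_equiv R v v'"
      using that by (simp_all add: word_class_def)
    then show ?thesis
      unfolding word_class_eq_iff by (intro word_equiv.sym[OF word_equiv.append])
  qed
  then have "(\<Union>u'\<in>word_class R u. \<Union>v'\<in>word_class R v. word_class R (u' @ v'))
      = (\<Union>u'\<in>word_class R u. \<Union>v'\<in>word_class R v. word_class R (u @ v))"
    by (simp cong: SUP_cong)
  moreover have "u \<in> word_class R u" "v \<in> word_class R v"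
    by (simp_all add: word_class_def word_equiv.refl)
  then have "word_class R u \<noteq> {}" "word_class R v \<noteq> {}"
    by blast+
  ultimately show ?thesis
    by (simp add: presented_group_def)
qed

lemma word_equiv_inverse: "word_equiv R (rev (map (\<lambda>(x, e). (x, \<not> e)) u) @ u) []"
proof (induction u)
  case Nil
  show ?case by (simp add: word_equiv.refl)
next
  case (Cons l u)
  obtain x e where l: "l = (x, e)" by (cases l)
  let ?i = "rev (map (\<lambda>(x, e). (x, \<not> e)) u)"
  have "word_equiv R [(x, \<not> e), (x, e)] []"
    using word_equiv.cancel[of R x "\<not> e"] by simp
  then have "word_equiv R (?i @ ([(x, \<not> e), (x, e)] @ u)) (?i @ ([] @ u))"
    by (intro word_equiv.append word_equiv.refl)
  then show ?case
    using word_equiv.trans[OF _ Cons.IH] by (simp add: l)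
qed

lemma group_presented_group: "group (presented_group R)"
proof (rule groupI)
  have c: "carrier (presented_group R) = range (word_class R)"
    and o: "\<one>\<^bsub>presented_group R\<^esub> = word_class R []"
    unfolding presented_group_def by simp_all
  show "\<one>\<^bsub>presented_group R\<^esub> \<in> carrier (presented_group R)"
    by (simp add: c o)
  fix U assume U: "U \<in> carrier (presented_group R)"
  then show "\<one>\<^bsub>presented_group R\<^esub> \<otimes>\<^bsub>presented_group R\<^esub> U = U"
    by (auto simp: c o word_class_mult)
  show "\<exists>V\<in>carrier (presented_group R). V \<otimes>\<^bsub>presented_group R\<^esub> U = \<one>\<^bsub>presented_group R\<^esub>"
  proof -
    obtain u where "U = word_class R u" using U by (auto simp: c)
    then have "word_class R (rev (map (\<lambda>(x, e). (x, \<not> e)) u)) \<otimes>\<^bsub>presented_group R\<^esub> U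
        = \<one>\<^bsub>presented_group R\<^esub>"
      by (simp add: word_class_mult o word_class_eq_iff word_equiv_inverse)
    then show ?thesis by (auto simp: c)
  qed
  fix V assume V: "V \<in> carrier (presented_group R)"
  show "U \<otimes>\<^bsub>presented_group R\<^esub> V \<in> carrier (presented_group R)"
    using U V by (auto simp: c word_class_mult)
  fix W assume "W \<in> carrier (presented_group R)"
  then show "U \<otimes>\<^bsub>presented_group R\<^esub> V \<otimes>\<^bsub>presented_group R\<^esub> W
      = U \<otimes>\<^bsub>presented_group R\<^esub> (V \<otimes>\<^bsub>presented_group R\<^esub> W)"
    using U V by (auto simp: c word_class_mult)
qed

section \<open>The dicyclic groups\<close>

datatype dicyclic_generator = Gen_a | Gen_b

text \<open>The relations are \<open>a^(2m) = 1\<close>, \<open>b^2 = a^m\<close> and \<open>b a b^(-1) = a^(-1)\<close>.\<close>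

definition dicyclic_group :: "nat \<Rightarrow> dicyclic_generator word set monoid" where
  "dicyclic_group m = presented_group
     {(replicate (2 * m) (Gen_a, True), []),
      (replicate 2 (Gen_b, True), replicate m (Gen_a, True)),
      ([(Gen_b, True), (Gen_a, True), (Gen_b, False)], [(Gen_a, False)])}"

section \<open>Finite simple graphs and Zagreb indices\<close>

text \<open>An edge is the two-element set of its endpoints.\<close>

record 'v simple_graph =
  vertices :: "'v set"
  edges :: "'v set set"

definition degree :: "'v simple_graph \<Rightarrow> 'v \<Rightarrow> nat" where
  "degree \<Gamma> v = card {e \<in> edges \<Gamma>. v \<in> e}"

definition zagreb1 :: "'v simple_graph \<Rightarrow> nat" where
  "zagreb1 \<Gamma> = (\<Sum>v\<in>vertices \<Gamma>. (degree \<Gamma> v)\<^sup>2)"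

text \<open>For an edge \<open>e = {u, v}\<close> the inner product is \<open>deg u * deg v\<close>.\<close>

definition zagreb2 :: "'v simple_graph \<Rightarrow> nat" where
  "zagreb2 \<Gamma> = (\<Sum>e\<in>edges \<Gamma>. \<Prod>v\<in>e. degree \<Gamma> v)"

section \<open>The commuting conjugacy class graph\<close>

definition conjugacy_class :: "('a, 'b) monoid_scheme \<Rightarrow> 'a \<Rightarrow> 'a set" where
  "conjugacy_class G x = orbit G (\<lambda>g h. g \<otimes>\<^bsub>G\<^esub> h \<otimes>\<^bsub>G\<^esub> inv\<^bsub>G\<^esub> g) x"

definition group_center :: "('a, 'b) monoid_scheme \<Rightarrow> 'a set" where
  "group_center G = {z \<in> carrier G. \<forall>g\<in>carrier G. z \<otimes>\<^bsub>G\<^esub> g = g \<otimes>\<^bsub>G\<^esub> z}"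

definition ccc_graph :: "('a, 'b) monoid_scheme \<Rightarrow> 'a set simple_graph" where
  "ccc_graph G =
    (let V = conjugacy_class G ` (carrier G - group_center G)
     in \<lparr>vertices = V,
         edges = {{X, Y} | X Y. X \<in> V \<and> Y \<in> V \<and> X \<noteq> Y \<and>
                    (\<exists>x\<in>X. \<exists>y\<in>Y. x \<otimes>\<^bsub>G\<^esub> y = y \<otimes>\<^bsub>G\<^esub> x)}\<rparr>)"

end

theory Submission
  imports Defs
begin

text \<open>Every element of the group is \<open>a^i\<close> or \<open>a^i b\<close>. The non-central classes are the \<open>m - 1\<close> classes
  \<open>{a^i, a^(-i)}\<close> with \<open>0 < i < m\<close>, which commute pairwise, and the two classes of the \<open>a^i b\<close> with
  \<open>i\<close> of fixed parity, which commute with none of the former. Since \<open>a^i b\<close> and \<open>a^j b\<close> commute iff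
  \<open>m\<close> divides \<open>i - j\<close>, these two are adjacent exactly for odd \<open>m\<close>. So the graph is a disjoint union
  of cliques, \<open>K_(m-1) + 2 K_1\<close> or \<open>K_(m-1) + K_2\<close>. That the group has no further collapse
  is seen from its action on the \<open>4 m\<close> normal forms.\<close>

section \<open>Disjoint unions of cliques\<close>

definition pairs :: "'v set \<Rightarrow> 'v set set" where
  "pairs K = {e. e \<subseteq> K \<and> card e = 2}"

lemma pairs_iff: "e \<in> pairs K \<longleftrightarrow> (\<exists>v w. e = {v, w} \<and> v \<noteq> w \<and> v \<in> K \<and> w \<in> K)"
  by (auto simp: pairs_def card_2_iff)

lemma finite_pairs: "finite K \<Longrightarrow> finite (pairs K)"
  by (simp add: pairs_def)

lemma card_pairs: "finite K \<Longrightarrow> card (pairs K) = card K choose 2"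
  by (simp add: pairs_def n_subsets)

lemma disjoint_pairs: "K \<inter> L = {} \<Longrightarrow> pairs K \<inter> pairs L = {}"
  by (auto simp: pairs_def card_2_iff)

text \<open>An edge of the clique through \<open>v\<close> is determined by its other endpoint,
  which ranges over \<open>K - {v}\<close>.\<close>

lemma degree_clique:
  assumes "finite K" "v \<in> K"
  shows "card {e \<in> pairs K. v \<in> e} = card K - 1"
proof -
  have "bij_betw (\<lambda>w. {v, w}) (K - {v}) {e \<in> pairs K. v \<in> e}"
  proof (rule bij_betwI')
    show "({v, w} = {v, w'}) = (w = w')" if "w \<in> K - {v}" "w' \<in> K - {v}" for w w'
      using that by (auto simp: doubleton_eq_iff)
    show "{v, w} \<in> {e \<in> pairs K. v \<in> e}" if "w \<in> K - {v}" for w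
      using that assms by (auto simp: pairs_def)
    show "\<exists>w\<in>K - {v}. e = {v, w}" if "e \<in> {e \<in> pairs K. v \<in> e}" for e
      using that by (auto simp: pairs_def card_2_iff)
  qed
  from bij_betw_same_card[OF this] show ?thesis
    using assms by simp
qed

text \<open>Isolated vertices are covered as singleton members of \<open>P\<close>, whose set of
  pairs is empty.\<close>

locale clique_union =
  fixes \<Gamma> :: "'v simple_graph" and P :: "'v set set"
  assumes finite_P: "finite P"
    and finite_clique: "K \<in> P \<Longrightarrow> finite K"
    and disjoint_cliques: "K \<in> P \<Longrightarrow> L \<in> P \<Longrightarrow> K \<noteq> L \<Longrightarrow> K \<inter> L = {}"
    and vertices_eq: "vertices \<Gamma> = \<Union>P"
    and edges_eq: "edges \<Gamma> = (\<Union>K\<in>P. pairs K)"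
begin

lemma degree_eq:
  assumes "K \<in> P" "v \<in> K"
  shows "degree \<Gamma> v = card K - 1"
proof -
  have "{e \<in> edges \<Gamma>. v \<in> e} = {e \<in> pairs K. v \<in> e}"
    using assms disjoint_cliques by (auto simp: edges_eq pairs_def)
  then show ?thesis
    using degree_clique[OF finite_clique] assms by (simp add: degree_def)
qed

lemma sum_edges: "sum f (edges \<Gamma>) = (\<Sum>K\<in>P. sum f (pairs K))"
  unfolding edges_eq using finite_P finite_clique disjoint_cliques
  by (intro sum.UNION_disjoint) (simp_all add: finite_pairs disjoint_pairs)

lemma sum_vertices: "sum f (vertices \<Gamma>) = (\<Sum>K\<in>P. sum f K)"
  unfolding vertices_eq using finite_P finite_clique disjoint_cliques
  by (subst sum.Union_disjoint) simp_all

lemma card_vertices: "card (vertices \<Gamma>) = (\<Sum>K\<in>P. card K)"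
  unfolding card_eq_sum sum_vertices ..

lemma card_edges: "card (edges \<Gamma>) = (\<Sum>K\<in>P. card K choose 2)"
  unfolding card_eq_sum[of "edges \<Gamma>"] sum_edges
  by (simp add: card_pairs finite_clique)

lemma zagreb1_eq: "zagreb1 \<Gamma> = (\<Sum>K\<in>P. card K * (card K - 1)\<^sup>2)"
  unfolding zagreb1_def sum_vertices
  by (simp add: degree_eq)

text \<open>Both endpoints of an edge inside \<open>K\<close> have degree \<open>card K - 1\<close>,
  so all edges of \<open>K\<close> contribute alike.\<close>

lemma zagreb2_eq: "zagreb2 \<Gamma> = (\<Sum>K\<in>P. (card K choose 2) * (card K - 1)\<^sup>2)"
  unfolding zagreb2_def sum_edges
proof (rule sum.cong[OF HOL.refl])
  fix K assume K: "K \<in> P"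
  have "(\<Prod>v\<in>e. degree \<Gamma> v) = (card K - 1)\<^sup>2" if e: "e \<in> pairs K" for e
  proof -
    have "(\<Prod>v\<in>e. degree \<Gamma> v) = (\<Prod>v\<in>e. card K - 1)"
      using e K by (intro prod.cong) (auto simp: pairs_def degree_eq)
    then show ?thesis using e by (simp add: pairs_def)
  qed
  then show "(\<Sum>e\<in>pairs K. \<Prod>v\<in>e. degree \<Gamma> v) = (card K choose 2) * (card K - 1)\<^sup>2"
    using K by (simp add: card_pairs finite_clique)
qed

end

section \<open>Conjugacy and commutation in dicyclic groups\<close>

text \<open>Only the relations are assumed, so collapsed images such as the trivial group also
  qualify; the multiplication table already follows at this level.\<close>

locale dicyclic_relators = group G for G (structure) +
  fixes a b :: 'a and m :: nat
  assumes a_closed [simp]: "a \<in> carrier G" and b_closed [simp]: "b \<in> carrier G"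
    and a_pow_2m: "a [^] (2 * m) = \<one>"
    and b_square: "b \<otimes> b = a [^] m"
    and b_conj_a: "b \<otimes> a \<otimes> inv b = inv a"
begin

section \<open>Multiplication of the normal forms a^i and a^i b\<close>

definition x :: "int \<Rightarrow> 'a" where "x i = a [^] i"
definition y :: "int \<Rightarrow> 'a" where "y i = a [^] i \<otimes> b"

lemma x_closed [simp]: "x i \<in> carrier G" and y_closed [simp]: "y i \<in> carrier G"
  by (simp_all add: x_def y_def)

lemma b_mult_a: "b \<otimes> a = inv a \<otimes> b"
  using b_conj_a by (metis a_closed b_closed inv_closed inv_solve_right' m_closed)

lemma b_mult_a_nat_pow: "b \<otimes> a [^] (n::nat) = inv a [^] n \<otimes> b"
proof (induction n)
  case (Suc n)
  have "b \<otimes> a [^] Suc n = (b \<otimes> a [^] n) \<otimes> a"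
    by (simp add: m_assoc)
  also have "\<dots> = inv a [^] n \<otimes> (b \<otimes> a)"
    by (simp add: Suc m_assoc)
  also have "\<dots> = inv a [^] Suc n \<otimes> b"
    by (simp add: b_mult_a m_assoc)
  finally show ?case .
qed simp

lemma b_mult_x: "b \<otimes> x i = x (- i) \<otimes> b"
proof (cases i)
  case (nonneg n)
  then show ?thesis
    using b_mult_a_nat_pow[of n] by (simp add: x_def int_pow_int int_pow_neg nat_pow_inv)
next
  case (neg n)
  let ?p = "a [^] Suc n"
  have p: "?p \<in> carrier G" by simp
  \<comment> \<open>A negative exponent reduces to the natural power p = a^(n+1): multiplying b p =
    p^(-1) b by p on the left and by p^(-1) on the right gives p b = b p^(-1).\<close>
  have "b \<otimes> ?p = inv ?p \<otimes> b"
    using b_mult_a_nat_pow[of "Suc n"] by (simp only: nat_pow_inv a_closed)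
  then have "b = inv ?p \<otimes> b \<otimes> inv ?p"
    using p by (metis b_closed inv_closed inv_solve_right m_closed)
  then have "?p \<otimes> b = b \<otimes> inv ?p"
    using p by (metis b_closed inv_closed inv_solve_left m_assoc m_closed)
  moreover have "x i = inv ?p" "x (- i) = ?p"
    unfolding neg x_def using int_pow_neg_int[OF a_closed, of "Suc n"]
    by (simp_all only: minus_minus int_pow_int)
  ultimately show ?thesis by simp
qed

lemma x_mult_x: "x i \<otimes> x j = x (i + j)"
  by (simp add: x_def int_pow_mult)

lemma y_eq: "y i = x i \<otimes> b"
  by (simp add: x_def y_def)

lemma x_mult_y: "x i \<otimes> y j = y (i + j)"
  by (simp add: y_eq x_mult_x flip: m_assoc)

lemma y_mult_x: "y i \<otimes> x j = y (i - j)"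
  by (simp add: y_eq m_assoc b_mult_x) (simp add: x_mult_x flip: m_assoc)

lemma b_mult_b: "b \<otimes> b = x (int m)"
  by (simp add: b_square x_def int_pow_int)

text \<open>Moving b past a^j reverses the sign of j, and b^2 = a^m supplies the summand m.\<close>

lemma y_mult_y: "y i \<otimes> y j = x (i - j + int m)"
proof -
  have "y i \<otimes> y j = (y i \<otimes> x j) \<otimes> b"
    by (simp add: y_eq m_assoc)
  also have "\<dots> = x (i - j) \<otimes> (b \<otimes> b)"
    by (simp add: y_mult_x) (simp add: y_eq m_assoc)
  finally show ?thesis by (simp add: b_mult_b x_mult_x)
qed

lemma x_0: "x 0 = \<one>"
  by (simp add: x_def)

lemma x_2m: "x (2 * int m) = \<one>"
  using a_pow_2m int_pow_int[of G a "2 * m"] by (simp add: x_def)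

lemma x_mod: "x (i mod (2 * int m)) = x i"
proof -
  have "x i = x (2 * int m * (i div (2 * int m))) \<otimes> x (i mod (2 * int m))"
    by (simp add: x_mult_x)
  moreover have "x (2 * int m * k) = \<one>" for k
    using x_2m by (simp add: x_def flip: int_pow_pow)
  ultimately show ?thesis by simp
qed

lemma inv_x: "inv (x i) = x (- i)"
  by (simp add: x_def int_pow_neg)

text \<open>The shift by m makes the exponent of the product exactly 2m.\<close>

lemma inv_y: "inv (y i) = y (i + int m)"
  using inv_equality[of "y (i + int m)" "y i"] by (simp add: y_mult_y x_2m)

end

text \<open>These assumptions exclude any collapse: a has order exactly 2m and b lies outside its
  powers, so the normal forms give 4m distinct elements.\<close>

locale dicyclic = dicyclic_relators +
  assumes two_le_m: "2 \<le> m"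
    and carrier_subset: "carrier G \<subseteq> range x \<union> range y"
    and x_eq_one: "x i = \<one> \<Longrightarrow> 2 * int m dvd i"
    and x_neq_b: "x i \<noteq> b"
begin

section \<open>Equality of normal forms, commutation and the center\<close>

lemma carrier_eq: "carrier G = range x \<union> range y"
  using carrier_subset by auto

lemma x_eq_one_iff: "x i = \<one> \<longleftrightarrow> 2 * int m dvd i"
  using x_eq_one x_mod[of i] by (auto simp: x_0)

lemma x_eq_iff: "x i = x j \<longleftrightarrow> 2 * int m dvd i - j"
proof -
  have "x i = x j \<longleftrightarrow> x i \<otimes> inv (x j) = \<one>"
    by (metis r_inv x_closed inv_closed inv_equality inv_inv)
  then show ?thesis
    by (simp add: inv_x x_mult_x x_eq_one_iff)
qed

lemma y_eq_iff: "y i = y j \<longleftrightarrow> 2 * int m dvd i - j"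
  by (simp add: y_eq x_eq_iff)

lemma x_neq_y [simp]: "x i \<noteq> y j"
proof
  assume "x i = y j"
  then have "x (- j) \<otimes> x i = x (- j) \<otimes> (x j \<otimes> b)"
    by (simp add: y_eq)
  then have "x (i - j) = b"
    by (simp add: x_mult_x x_0 flip: m_assoc)
  then show False using x_neq_b by simp
qed

text \<open>The two products are \<open>y (i + j)\<close> and \<open>y (j - i)\<close>; their
  exponents differ by 2i, and the factor 2 cancels against the modulus 2m.\<close>

lemma x_y_commute_iff: "x i \<otimes> y j = y j \<otimes> x i \<longleftrightarrow> int m dvd i"
proof -
  have "x i \<otimes> y j = y j \<otimes> x i \<longleftrightarrow> 2 * int m dvd 2 * i"
    by (simp add: x_mult_y y_mult_x y_eq_iff)
  then show ?thesis by simp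
qed

lemma y_y_commute_iff: "y i \<otimes> y j = y j \<otimes> y i \<longleftrightarrow> int m dvd i - j"
proof -
  have "y i \<otimes> y j = y j \<otimes> y i \<longleftrightarrow> 2 * int m dvd 2 * (i - j)"
    by (simp add: y_mult_y x_eq_iff algebra_simps)
  then show ?thesis by (simp only: dvd_mult_cancel_left) simp
qed

lemma x_in_center_iff: "x i \<in> group_center G \<longleftrightarrow> int m dvd i"
  by (auto simp: group_center_def carrier_eq ball_Un x_y_commute_iff)
    (simp add: x_mult_x add.commute)

lemma y_notin_center: "y i \<notin> group_center G"
proof
  assume "y i \<in> group_center G"
  then have "y i \<otimes> x 1 = x 1 \<otimes> y i"
    by (auto simp: group_center_def)
  then have "int m dvd 1"
    using x_y_commute_iff[of 1 i] by simp
  then show False using two_le_m by simp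
qed

section \<open>Conjugacy classes\<close>

definition X :: "int \<Rightarrow> 'a set" where "X i = {x i, x (- i)}"
definition Y :: "int \<Rightarrow> 'a set" where "Y i = {y j | j. even (i - j)}"

lemma conjugacy_class_eq:
  "conjugacy_class G h = range (\<lambda>i. x i \<otimes> h \<otimes> inv (x i)) \<union> range (\<lambda>i. y i \<otimes> h \<otimes> inv (y i))"
  by (auto simp: conjugacy_class_def orbit_def carrier_eq)

text \<open>Conjugation by a power of a fixes a^i, and conjugation by a^j b inverts it.\<close>

lemma conjugacy_class_x: "conjugacy_class G (x i) = X i"
  by (auto simp: conjugacy_class_eq X_def inv_x inv_y x_mult_x x_mult_y y_mult_x y_mult_y)

text \<open>Every conjugation shifts the exponent by an even number, and conjugation by powers of a
  already yields every even shift.\<close>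

lemma conjugacy_class_y: "conjugacy_class G (y i) = Y i"
proof -
  have "x j \<otimes> y i \<otimes> inv (x j) = y (i + 2 * j)" for j
    by (simp add: inv_x x_mult_y y_mult_x algebra_simps)
  moreover have "y j \<otimes> y i \<otimes> inv (y j) = y (i + 2 * (j - i + int m))" for j
    by (simp add: inv_y x_mult_y y_mult_y algebra_simps)
  ultimately have "conjugacy_class G (y i) = range (\<lambda>j. y (i + 2 * j))"
    unfolding conjugacy_class_eq by (simp only:) blast
  also have "\<dots> = Y i"
  proof (intro equalityI subsetI)
    fix z assume "z \<in> Y i"
    then obtain j where j: "z = y j" "even (i - j)" by (auto simp: Y_def)
    then obtain k where "i - j = 2 * k" by blast
    then have "z = y (i + 2 * (- k))" using j by (simp add: algebra_simps)
    then show "z \<in> range (\<lambda>j. y (i + 2 * j))" by blast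
  qed (auto simp: Y_def)
  finally show ?thesis .
qed

lemma X_eq_iff: "X i = X j \<longleftrightarrow> 2 * int m dvd i - j \<or> 2 * int m dvd i + j"
proof -
  have "X i = X j \<longleftrightarrow> x i \<in> X j"
  proof
    assume "x i \<in> X j"
    then consider "x i = x j" | "x i = x (- j)" by (auto simp: X_def)
    then show "X i = X j"
    proof cases
      case 1
      then have "x (- i) = x (- j)" by (metis inv_x)
      with 1 show ?thesis by (simp add: X_def)
    next
      case 2
      then have "x (- i) = x j" by (metis inv_x minus_minus)
      with 2 show ?thesis by (auto simp: X_def)
    qed
  qed (auto simp: X_def)
  then show ?thesis by (simp add: X_def x_eq_iff)
qed

text \<open>Exponents are determined modulo 2m, which is even, so the parity of i depends only on
  the element a^i b.\<close>

lemma Y_eq_iff: "Y i = Y j \<longleftrightarrow> even (i - j)"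
proof
  assume "Y i = Y j"
  moreover have "y i \<in> Y i" by (auto simp: Y_def)
  ultimately obtain k where k: "y i = y k" "even (j - k)" by (auto simp: Y_def)
  then have "even (i - k)"
    using dvd_trans[of 2 "2 * int m" "i - k"] by (simp add: y_eq_iff)
  then show "even (i - j)" using k by simp
qed (auto simp: Y_def)

lemma X_neq_Y: "X i \<noteq> Y j"
proof -
  have "x i \<in> X i" "x i \<notin> Y j" by (auto simp: X_def Y_def)
  then show ?thesis by blast
qed

section \<open>Vertices of the graph\<close>

definition cyclic_classes :: "'a set set" where
  "cyclic_classes = X ` {i. \<not> int m dvd i}"

lemma Y_notin_cyclic_classes: "Y i \<notin> cyclic_classes"
  using X_neq_Y by (force simp: cyclic_classes_def)

lemma cyclic_classes_eq: "cyclic_classes = X ` {1..<int m}"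
proof (intro equalityI subsetI)
  fix K assume "K \<in> cyclic_classes"
  then obtain i where i: "K = X i" "\<not> int m dvd i" by (auto simp: cyclic_classes_def)
  \<comment> \<open>Reduction modulo 2m, followed if necessary by the reflection of r to 2m - r,
    brings the exponent into the range from 1 to m - 1; the fixed values 0 and m of the reflection
    are the central ones.\<close>
  define r where "r = i mod (2 * int m)"
  have d: "2 * int m dvd i - r" by (simp add: r_def)
  have r0: "0 \<le> r" "r < 2 * int m" using two_le_m by (simp_all add: r_def)
  have "int m dvd i - r" using d by (rule dvd_mult_right)
  then have nr: "\<not> int m dvd r" using i(2) by (metis dvd_diff_right_iff dvd_diffD diff_add_cancel dvd_add)
  then have r: "r \<noteq> 0" "r \<noteq> int m" by auto
  show "K \<in> X ` {1..<int m}"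
  proof (cases "r < int m")
    case True
    moreover have "K = X r" using d i by (simp add: X_eq_iff)
    ultimately show ?thesis using r r0 by auto
  next
    case False
    have "2 * int m dvd i + (2 * int m - r)"
      using d by (metis add_diff_eq add.commute dvd_add dvd_refl diff_add_eq)
    then have "K = X (2 * int m - r)" using i by (simp add: X_eq_iff)
    moreover have "2 * int m - r \<in> {1..<int m}" using False r r0 by auto
    ultimately show ?thesis by blast
  qed
next
  fix K assume "K \<in> X ` {1..<int m}"
  then obtain i where i: "K = X i" "1 \<le> i" "i < int m" by auto
  then have "\<not> int m dvd i" using zdvd_imp_le[of "int m" i] by auto
  with i show "K \<in> cyclic_classes" by (auto simp: cyclic_classes_def)
qed

lemma card_cyclic_classes: "card cyclic_classes = m - 1"
proof -
  have "inj_on X {1..<int m}"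
  proof (rule inj_onI)
    fix i j assume ij: "i \<in> {1..<int m}" "j \<in> {1..<int m}" "X i = X j"
    \<comment> \<open>The sum lies strictly between 0 and 2m, which excludes the second alternative
      of \<open>X_eq_iff\<close>.\<close>
    have "\<not> 2 * int m dvd i + j" using ij by (auto dest: zdvd_imp_le)
    then have "2 * int m dvd i - j" using ij by (simp add: X_eq_iff)
    then show "i = j"
      using ij dvd_imp_le_int[of "i - j" "2 * int m"] by (cases "i = j") auto
  qed
  then show ?thesis by (simp add: cyclic_classes_eq card_image)
qed

lemma range_Y: "range Y = {Y 0, Y 1}"
proof -
  have "Y i = Y 0 \<or> Y i = Y 1" for i by (simp add: Y_eq_iff)
  then show ?thesis by auto
qed

lemma Y_0_neq_Y_1: "Y 0 \<noteq> Y 1"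
  by (simp add: Y_eq_iff)

lemma vertices_ccc: "vertices (ccc_graph G) = cyclic_classes \<union> {Y 0, Y 1}"
proof -
  have "carrier G - group_center G = x ` {i. \<not> int m dvd i} \<union> range y"
    using y_notin_center by (auto simp: carrier_eq x_in_center_iff)
  then have "vertices (ccc_graph G) = cyclic_classes \<union> range Y"
    by (simp add: ccc_graph_def cyclic_classes_def image_Un image_image
        conjugacy_class_x conjugacy_class_y)
  then show ?thesis by (simp only: range_Y)
qed

section \<open>Adjacency and the clique decomposition\<close>

definition cliques :: "'a set set set" where
  "cliques = (if even m then {cyclic_classes, {Y 0}, {Y 1}} else {cyclic_classes, {Y 0, Y 1}})"

definition meets :: "'a set \<Rightarrow> 'a set \<Rightarrow> bool" where
  "meets K L \<longleftrightarrow> (\<exists>g\<in>K. \<exists>h\<in>L. g \<otimes> h = h \<otimes> g)"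

lemma meets_sym: "meets K L \<longleftrightarrow> meets L K"
  unfolding meets_def by metis

lemma meets_X_X: "meets (X i) (X j)"
  by (auto simp: meets_def X_def x_mult_x add.commute)

lemma meets_X_Y: "meets (X i) (Y j) \<longleftrightarrow> int m dvd i"
proof
  assume "int m dvd i"
  then have "x i \<otimes> y j = y j \<otimes> x i" by (simp add: x_y_commute_iff)
  moreover have "x i \<in> X i" "y j \<in> Y j" by (auto simp: X_def Y_def)
  ultimately show "meets (X i) (Y j)" unfolding meets_def by blast
qed (auto simp: meets_def X_def Y_def x_y_commute_iff)

lemma meets_Y_Y: "meets (Y 0) (Y 1) \<longleftrightarrow> odd m"
proof
  assume "meets (Y 0) (Y 1)"
  then obtain i j where ij: "even i" "even (1 - j)" "int m dvd i - j"
    by (auto simp: meets_def Y_def y_y_commute_iff)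
  show "odd m"
  proof
    assume "even m"
    then have "even (i - j)" using ij(3) by (meson dvd_trans even_of_nat)
    then show False using ij by simp
  qed
next
  assume "odd m"
  \<comment> \<open>For odd m the exponents 0 and m have different parity, yet they differ by a
    multiple of m.\<close>
  then have "y 0 \<in> Y 0" "y (int m) \<in> Y 1" "int m dvd 0 - int m" by (auto simp: Y_def)
  then show "meets (Y 0) (Y 1)"
    unfolding meets_def using y_y_commute_iff by blast
qed

lemma edge_iff:
  "e \<in> edges (ccc_graph G) \<longleftrightarrow> (\<exists>K L. e = {K, L} \<and> K \<in> cyclic_classes \<union> {Y 0, Y 1} \<and>
     L \<in> cyclic_classes \<union> {Y 0, Y 1} \<and> K \<noteq> L \<and> meets K L)"
proof -
  have "conjugacy_class G ` (carrier G - group_center G) = cyclic_classes \<union> {Y 0, Y 1}"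
    using vertices_ccc by (simp add: ccc_graph_def Let_def)
  then have "edges (ccc_graph G) = {{K, L} | K L. K \<in> cyclic_classes \<union> {Y 0, Y 1} \<and>
      L \<in> cyclic_classes \<union> {Y 0, Y 1} \<and> K \<noteq> L \<and> meets K L}"
    by (simp add: ccc_graph_def Let_def meets_def)
  then show ?thesis by (simp only: mem_Collect_eq)
qed

text \<open>Splitting the vertices into classes of powers of a and the two classes
  \<open>Y 0\<close>, \<open>Y 1\<close> leaves five cases, each settled by one commutation lemma.
  The parity of m enters only through \<open>Y 0\<close> against \<open>Y 1\<close>.\<close>

lemma meets_iff:
  assumes K: "K \<in> cyclic_classes \<union> {Y 0, Y 1}" and L: "L \<in> cyclic_classes \<union> {Y 0, Y 1}"
    and "K \<noteq> L"
  shows "meets K L \<longleftrightarrow> (\<exists>C\<in>cliques. K \<in> C \<and> L \<in> C)"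
proof -
  have XX: "meets K L" if "K \<in> cyclic_classes" "L \<in> cyclic_classes" for K L
    using that meets_X_X by (auto simp: cyclic_classes_def)
  have XY: "\<not> meets K (Y i)" if "K \<in> cyclic_classes" for K i
    using that by (auto simp: cyclic_classes_def meets_X_Y)
  then have YX: "\<not> meets (Y i) K" if "K \<in> cyclic_classes" for K i
    using that meets_sym by blast
  have YY: "meets (Y 1) (Y 0) \<longleftrightarrow> odd m"
    using meets_Y_Y meets_sym by blast
  consider "K \<in> cyclic_classes" "L \<in> cyclic_classes"
    | i where "K \<in> cyclic_classes" "L = Y i" | i where "K = Y i" "L \<in> cyclic_classes"
    | "K = Y 0" "L = Y 1" | "K = Y 1" "L = Y 0"
    using assms by auto
  then show ?thesis
  proof cases
    case 1
    then show ?thesis using XX by (auto simp: cliques_def)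
  next
    case 2
    then show ?thesis using XY Y_notin_cyclic_classes by (auto simp: cliques_def)
  next
    case 3
    then show ?thesis using YX Y_notin_cyclic_classes by (auto simp: cliques_def)
  next
    case 4
    then show ?thesis using meets_Y_Y Y_notin_cyclic_classes Y_0_neq_Y_1
      by (auto simp: cliques_def)
  next
    case 5
    then show ?thesis using YY Y_notin_cyclic_classes Y_0_neq_Y_1
      by (auto simp: cliques_def)
  qed
qed

sublocale ccc: clique_union "ccc_graph G" cliques
proof
  show "finite cliques" by (simp add: cliques_def)
  show "finite K" if "K \<in> cliques" for K
    using that by (auto simp: cliques_def cyclic_classes_eq split: if_splits)
  show "K \<inter> L = {}" if "K \<in> cliques" "L \<in> cliques" "K \<noteq> L" for K L
    using that Y_notin_cyclic_classes Y_0_neq_Y_1 by (auto simp: cliques_def split: if_splits)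
  show vertices: "vertices (ccc_graph G) = \<Union>cliques"
    unfolding vertices_ccc by (auto simp: cliques_def)
  show "edges (ccc_graph G) = (\<Union>K\<in>cliques. pairs K)"
  proof (rule Set.set_eqI)
    fix e
    \<comment> \<open>Members of a clique are automatically vertices, so the vertex conditions of
      \<open>edge_iff\<close> are absorbed.\<close>
    have "e \<in> edges (ccc_graph G) \<longleftrightarrow>
        (\<exists>K L. e = {K, L} \<and> K \<noteq> L \<and> (\<exists>C\<in>cliques. K \<in> C \<and> L \<in> C))"
      unfolding edge_iff using meets_iff vertices vertices_ccc by (smt (verit) UnionI)
    then show "e \<in> edges (ccc_graph G) \<longleftrightarrow> e \<in> (\<Union>K\<in>cliques. pairs K)"
      unfolding UN_iff pairs_iff by blast
  qed
qed

text \<open>Summing a function of the size alone serves both cardinalities and both indices at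
  once.\<close>

lemma sum_cliques:
  "(\<Sum>K\<in>cliques. f (card K)) = f (m - 1) + (if even m then 2 * f 1 else f (2::nat))"
  for f :: "nat \<Rightarrow> nat"
proof -
  \<comment> \<open>For m = 2 and m = 3 the clique of powers of a has the same size as another
    clique, so they are told apart by their members; a coincidence would lose a term of the
    sum.\<close>
  have "cyclic_classes \<noteq> {Y 0}" "cyclic_classes \<noteq> {Y 1}" "cyclic_classes \<noteq> {Y 0, Y 1}"
    using Y_notin_cyclic_classes by auto
  then show ?thesis
    using Y_0_neq_Y_1 by (simp add: cliques_def card_cyclic_classes numeral_2_eq_2)
qed

end

section \<open>The presented group\<close>

text \<open>An action of the letters that respects cancellation and the relations is constant on
  word classes, so it can separate them. The state \<open>s\<close> varies in the induction because
  in \<open>u @ v\<close> the word \<open>u\<close> acts on the result of \<open>v\<close>.\<close>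

lemma word_equiv_foldr_eq:
  fixes act :: "'x \<times> bool \<Rightarrow> 's \<Rightarrow> 's"
  assumes equiv: "word_equiv R u v"
    and closed: "\<And>l s. s \<in> S \<Longrightarrow> act l s \<in> S"
    and cancel: "\<And>z e s. s \<in> S \<Longrightarrow> act (z, e) (act (z, \<not> e) s) = s"
    and relation: "\<And>u v s. (u, v) \<in> R \<Longrightarrow> s \<in> S \<Longrightarrow> foldr act u s = foldr act v s"
    and s: "s \<in> S"
  shows "foldr act u s = foldr act v s"
proof -
  have foldr_closed: "foldr act w t \<in> S" if "t \<in> S" for w t
    using that closed by (induction w) auto
  from equiv s show ?thesis
  proof (induction arbitrary: s)
    case (append u u' v v')
    then show ?case by (simp add: foldr_closed)
  qed (simp_all add: cancel relation)
qed

text \<open>Left multiplication by a letter on normal forms: the pair \<open>(i, s)\<close> stands for \<open>a^i\<close> if \<open>s\<close> is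
  false and for \<open>a^i b\<close> if \<open>s\<close> is true, with \<open>0 \<le> i < 2m\<close>.\<close>

fun dicyclic_act ::
  "nat \<Rightarrow> dicyclic_generator \<times> bool \<Rightarrow> int \<times> bool \<Rightarrow> int \<times> bool" where
  "dicyclic_act m (Gen_a, e) (i, s) = ((if e then i + 1 else i - 1) mod (2 * int m), s)"
| "dicyclic_act m (Gen_b, e) (i, s) = ((if e = s then int m - i else - i) mod (2 * int m), \<not> s)"

text \<open>The case n = 0 is separate because without a letter nothing reduces i modulo 2m.\<close>

lemma dicyclic_act_a_power:
  "foldr (dicyclic_act m) (replicate n (Gen_a, True)) (i, s) =
     (if n = 0 then (i, s) else ((i + int n) mod (2 * int m), s))"
  by (induction n) (auto simp: mod_simps ac_simps)

definition dicyclic_relations :: "nat \<Rightarrow> (dicyclic_generator word \<times> dicyclic_generator word) set"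
  where "dicyclic_relations m =
     {(replicate (2 * m) (Gen_a, True), []),
      (replicate 2 (Gen_b, True), replicate m (Gen_a, True)),
      ([(Gen_b, True), (Gen_a, True), (Gen_b, False)], [(Gen_a, False)])}"

lemma dicyclic_group_eq: "dicyclic_group m = presented_group (dicyclic_relations m)"
  by (simp only: dicyclic_group_def dicyclic_relations_def)

text \<open>Acting on \<open>(0, False)\<close>, the normal form of 1, a word produces its own
  normal form, which is thus an invariant of its class.\<close>

lemma dicyclic_word_foldr_eq:
  assumes m: "0 < m"
    and eq: "word_class (dicyclic_relations m) u = word_class (dicyclic_relations m) v"
  shows "foldr (dicyclic_act m) u (0, False) = foldr (dicyclic_act m) v (0, False)"
proof (rule word_equiv_foldr_eq[where S = "{0..<2 * int m} \<times> UNIV"])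
  show "word_equiv (dicyclic_relations m) u v" using eq by (simp add: word_class_eq_iff)
  show "dicyclic_act m l s \<in> {0..<2 * int m} \<times> UNIV" for l s
    using m by (cases "(m, l, s)" rule: dicyclic_act.cases) auto
  show "dicyclic_act m (z, e) (dicyclic_act m (z, \<not> e) s) = s"
    if "s \<in> {0..<2 * int m} \<times> UNIV" for z e s
    using that by (cases z; cases s) (auto simp: mod_simps)
  show "foldr (dicyclic_act m) u s = foldr (dicyclic_act m) v s"
    if R: "(u, v) \<in> dicyclic_relations m" and S: "s \<in> {0..<2 * int m} \<times> UNIV" for u v s
  proof -
    obtain i t where s: "s = (i, t)" "0 \<le> i" "i < 2 * int m" using S by auto
    have two: "replicate 2 l = [l, l]" for l :: "dicyclic_generator \<times> bool"
      by (simp add: numeral_2_eq_2)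
    \<comment> \<open>Acting twice by b shifts the exponent of a^i by m but that of a^i b by -m; the
      two shifts agree modulo 2m.\<close>
    have minus_m: "(i - int m) mod (2 * int m) = (i + int m) mod (2 * int m)"
      by (simp add: mod_eq_dvd_iff)
    consider "u = replicate (2 * m) (Gen_a, True)" "v = []"
      | "u = [(Gen_b, True), (Gen_b, True)]" "v = replicate m (Gen_a, True)"
      | "u = [(Gen_b, True), (Gen_a, True), (Gen_b, False)]" "v = [(Gen_a, False)]"
      using R unfolding dicyclic_relations_def two by blast
    then show ?thesis
    proof cases
      case 1
      then show ?thesis using s m by (simp del: foldr_replicate add: dicyclic_act_a_power)
    next
      case 2
      then show ?thesis using s m minus_m
        by (simp del: foldr_replicate add: dicyclic_act_a_power mod_simps algebra_simps)
    next
      case 3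
      then show ?thesis using s by (simp add: mod_simps algebra_simps)
    qed
  qed
  show "(0, False) \<in> {0..<2 * int m} \<times> (UNIV :: bool set)" using m by simp
qed

section \<open>Powers, inverses and absence of collapse in the presented group\<close>

lemma word_class_nat_pow:
  "word_class R [l] [^]\<^bsub>presented_group R\<^esub> (n::nat) = word_class R (replicate n l)"
proof -
  interpret group "presented_group R" by (rule group_presented_group)
  show ?thesis
  proof (induction n)
    case 0
    show ?case by (simp add: presented_group_def)
  next
    case (Suc n)
    then show ?case by (simp add: word_class_mult flip: replicate_append_same)
  qed
qed

lemma word_class_closed: "word_class R u \<in> carrier (presented_group R)"
  by (simp add: presented_group_def)

lemma inv_word_class:
  "inv\<^bsub>presented_group R\<^esub> word_class R [(z, e)] = word_class R [(z, \<not> e)]"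
proof -
  interpret group "presented_group R" by (rule group_presented_group)
  have "word_equiv R [(z, \<not> e), (z, e)] []"
    using word_equiv.cancel[of R z "\<not> e"] by simp
  then have "word_class R [(z, \<not> e)] \<otimes>\<^bsub>presented_group R\<^esub> word_class R [(z, e)]
      = \<one>\<^bsub>presented_group R\<^esub>"
    by (simp add: word_class_mult word_class_eq_iff) (simp add: presented_group_def word_class_eq_iff)
  then show ?thesis by (intro inv_equality) (simp_all add: word_class_closed)
qed

text \<open>The relations first give the multiplication table; with it, induction on words brings
  every class to normal form, and the action on \<open>(0, False)\<close> rules out
  collapse.\<close>

lemma dicyclic_dicyclic_group:
  assumes m: "2 \<le> m"
  defines "R \<equiv> dicyclic_relations m"
  shows "dicyclic (dicyclic_group m) (word_class R [(Gen_a, True)]) (word_class R [(Gen_b, True)]) m"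
proof -
  let ?a = "word_class R [(Gen_a, True)]" and ?b = "word_class R [(Gen_b, True)]"
  have one: "\<one>\<^bsub>presented_group R\<^esub> = word_class R []"
    by (simp add: presented_group_def)
  have rel: "word_class R u = word_class R v" if "(u, v) \<in> R" for u v
    using that by (simp add: word_class_eq_iff word_equiv.relation)
  interpret dicyclic_relators "presented_group R" ?a ?b m
  proof (intro dicyclic_relators.intro dicyclic_relators_axioms.intro group_presented_group)
    show "?a [^]\<^bsub>presented_group R\<^esub> (2 * m) = \<one>\<^bsub>presented_group R\<^esub>"
      unfolding word_class_nat_pow one by (rule rel) (simp add: R_def dicyclic_relations_def)
    show "?b \<otimes>\<^bsub>presented_group R\<^esub> ?b = ?a [^]\<^bsub>presented_group R\<^esub> m"
      unfolding word_class_nat_pow word_class_mult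
      by (rule rel) (simp add: R_def dicyclic_relations_def numeral_2_eq_2)
    show "?b \<otimes>\<^bsub>presented_group R\<^esub> ?a \<otimes>\<^bsub>presented_group R\<^esub> inv\<^bsub>presented_group R\<^esub> ?b
        = inv\<^bsub>presented_group R\<^esub> ?a"
      unfolding inv_word_class word_class_mult
      by (rule rel) (simp add: R_def dicyclic_relations_def)
  qed (simp_all add: word_class_closed)
  have a: "?a = x 1" and inv_a: "word_class R [(Gen_a, False)] = x (- 1)"
    using inv_x[of 1] inv_word_class[of R Gen_a True] by (simp_all add: x_def word_class_closed)
  have b: "?b = y 0"
    by (simp add: y_def word_class_closed)
  then have inv_b: "word_class R [(Gen_b, False)] = y (int m)"
    using inv_y[of 0] inv_word_class[of R Gen_b True] by simp
  have letter: "word_class R [l] \<in> range x \<union> range y" for l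
  proof -
    have "l \<in> {(Gen_a, True), (Gen_a, False), (Gen_b, True), (Gen_b, False)}"
      by (cases l; cases "fst l") auto
    then show ?thesis using a b inv_a inv_b by auto
  qed
  \<comment> \<open>A reduced nonnegative exponent turns \<open>x i\<close> into the class of an
    explicit word without inverse letters, on which the action can be evaluated.\<close>
  have x_nat: "x i = word_class R (replicate (nat (i mod (2 * int m))) (Gen_a, True))" for i
  proof -
    have "x i = ?a [^]\<^bsub>presented_group R\<^esub> int (nat (i mod (2 * int m)))"
      using m by (simp flip: x_mod[of i]) (simp add: x_def)
    then show ?thesis by (simp only: int_pow_int word_class_nat_pow)
  qed
  have act_x: "foldr (dicyclic_act m) (replicate (nat (i mod (2 * int m))) (Gen_a, True)) (0, False)
      = (i mod (2 * int m), False)" for i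
    using m by (simp del: foldr_replicate add: dicyclic_act_a_power)
      (metis of_nat_0_less_iff pos_mod_sign less_le_trans mult_pos_pos zero_less_numeral order_antisym_conv)
  show ?thesis
    unfolding dicyclic_group_eq R_def[symmetric]
  proof
    show "2 \<le> m" by fact
    show "carrier (presented_group R) \<subseteq> range x \<union> range y"
    proof
      fix g assume "g \<in> carrier (presented_group R)"
      then obtain u where "g = word_class R u" by (auto simp: presented_group_def)
      moreover have "word_class R u \<in> range x \<union> range y"
      proof (induction u)
        case Nil
        show ?case using x_0 by (metis UnI1 one rangeI)
      next
        case (Cons l u)
        have "word_class R (l # u) = word_class R [l] \<otimes>\<^bsub>presented_group R\<^esub> word_class R u"
          by (simp add: word_class_mult)
        then show ?case using letter[of l] Cons
          by (auto simp: x_mult_x x_mult_y y_mult_x y_mult_y)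
      qed
      ultimately show "g \<in> range x \<union> range y" by simp
    qed
    show "2 * int m dvd i" if "x i = \<one>\<^bsub>presented_group R\<^esub>" for i
    proof -
      have "(i mod (2 * int m), False) = (0, False)"
        using dicyclic_word_foldr_eq[of m "replicate (nat (i mod (2 * int m))) (Gen_a, True)" "[]",
            folded R_def]
          that m act_x[of i] by (simp del: foldr_replicate add: x_nat one)
      then show ?thesis by auto
    qed
    show "x i \<noteq> ?b" for i
    proof
      assume "x i = ?b"
      \<comment> \<open>The second component of the state separates the two words: the letter b
        flips it, the letter a does not.\<close>
      then have "(i mod (2 * int m), False) = dicyclic_act m (Gen_b, True) (0, False)"
        using dicyclic_word_foldr_eq
            [of m "replicate (nat (i mod (2 * int m))) (Gen_a, True)" "[(Gen_b, True)]",
              folded R_def]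
          m act_x[of i] by (simp del: foldr_replicate add: x_nat)
      then show False by simp
    qed
  qed
qed

section \<open>Evaluation of the indices and the inequality\<close>

theorem theorem2p3:
  fixes m :: nat
    and G :: "dicyclic_generator word set monoid"
    and \<Gamma> :: "dicyclic_generator word set set simple_graph"
  assumes "m \<ge> 2"
    and "G = dicyclic_group m"
    and "\<Gamma> = ccc_graph G"
  shows "real (zagreb1 \<Gamma>) =
           (if even m then (real m - 1) * (real m - 2)^2
            else (real m - 1) * (real m - 2)^2 + 2)
       \<and> real (zagreb2 \<Gamma>) =
           (if even m then (real m - 1) * (real m - 2)^3 / 2
            else (real m - 1) * (real m - 2)^3 / 2 + 1)
       \<and> real (zagreb2 \<Gamma>) / real (card (edges \<Gamma>)) \<ge>
           real (zagreb1 \<Gamma>) / real (card (vertices \<Gamma>))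
       \<and> (m = 2 \<or> m = 3 \<longrightarrow>
           real (zagreb2 \<Gamma>) / real (card (edges \<Gamma>)) =
           real (zagreb1 \<Gamma>) / real (card (vertices \<Gamma>)))"
proof -
  interpret dicyclic G "word_class (dicyclic_relations m) [(Gen_a, True)]"
    "word_class (dicyclic_relations m) [(Gen_b, True)]" m
    unfolding assms(2) using assms(1) by (rule dicyclic_dicyclic_group)
  \<comment> \<open>This is the degree of every vertex in the clique of m - 1 classes.\<close>
  define k where "k = real m - 2"
  have k: "real m = k + 2" "0 \<le> k" "real (m - 1) = k + 1" "real (m - 1 - 1) = k"
    using assms(1) by (simp_all add: k_def of_nat_diff)
  have choose: "real ((m - 1) choose 2) = (k + 1) * k / 2"
    using k by (simp add: choose_two real_of_nat_div even_Suc)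
  have v: "real (card (vertices \<Gamma>)) = k + 3"
    unfolding assms(3) ccc.card_vertices sum_cliques[of "\<lambda>n. n"] using k by simp
  have e: "real (card (edges \<Gamma>)) = (k + 1) * k / 2 + (if even m then 0 else 1)"
    unfolding assms(3) ccc.card_edges sum_cliques[of "\<lambda>n. n choose 2"]
    using choose by simp
  have z1: "real (zagreb1 \<Gamma>) = (k + 1) * k\<^sup>2 + (if even m then 0 else 2)"
    unfolding assms(3) ccc.zagreb1_eq sum_cliques[of "\<lambda>n. n * (n - 1)\<^sup>2"]
    using k by (simp del: diff_diff_left)
  have z2: "real (zagreb2 \<Gamma>) = (k + 1) * k ^ 3 / 2 + (if even m then 0 else 1)"
    unfolding assms(3) ccc.zagreb2_eq sum_cliques[of "\<lambda>n. (n choose 2) * (n - 1)\<^sup>2"]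
    using k choose by (simp del: diff_diff_left) (simp add: power2_eq_square power3_eq_cube)
  have "real (zagreb1 \<Gamma>) / real (card (vertices \<Gamma>)) \<le>
      real (zagreb2 \<Gamma>) / real (card (edges \<Gamma>))"
  proof (cases "even m")
    case True
    show ?thesis
    \<comment> \<open>For k = 0 the graph has no edges, and division by zero yields 0, in line with
      the convention for edgeless graphs.\<close>
    proof (cases "k = 0")
      case False
      then have "real (card (edges \<Gamma>)) \<noteq> 0"
        using True k by (simp add: e)
      \<comment> \<open>For even m every edge lies in the one clique of degree k, so each
        contributes k^2.\<close>
      moreover have "real (zagreb2 \<Gamma>) = k\<^sup>2 * real (card (edges \<Gamma>))"
        using True by (simp add: z2 e power2_eq_square power3_eq_cube)
      ultimately have "real (zagreb2 \<Gamma>) / real (card (edges \<Gamma>)) = k\<^sup>2"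
        by simp
      moreover have "(k + 1) * k\<^sup>2 \<le> k\<^sup>2 * (k + 3)"
        by (simp add: algebra_simps)
      ultimately show ?thesis using True k by (simp add: z1 v divide_le_eq)
    qed (simp add: z1 z2 True)
  next
    case False
    \<comment> \<open>Cross-multiplying the two quotients leaves a square, which vanishes at \<open>m = 3\<close>.\<close>
    have "((k + 1) * k ^ 3 + 2) * (k + 3) - ((k + 1) * k\<^sup>2 + 2) * ((k + 1) * k + 2)
        = 2 * (k\<^sup>2 - 1)\<^sup>2"
      by (simp add: power2_eq_square power3_eq_cube algebra_simps)
    then have "((k + 1) * k\<^sup>2 + 2) * ((k + 1) * k + 2) \<le> ((k + 1) * k ^ 3 + 2) * (k + 3)"
      by (metis diff_ge_0_iff_ge zero_le_mult_iff zero_le_numeral zero_le_power2)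
    moreover have "0 < (k + 1) * k + 2" using k by (simp add: add_nonneg_pos)
    ultimately have "((k + 1) * k\<^sup>2 + 2) / (k + 3) \<le> ((k + 1) * k ^ 3 + 2) / ((k + 1) * k + 2)"
      using k by (simp add: divide_simps)
    also have "\<dots> = ((k + 1) * k ^ 3 / 2 + 1) / ((k + 1) * k / 2 + 1)"
      using \<open>0 < (k + 1) * k + 2\<close> by (simp add: divide_simps) (simp add: algebra_simps)
    finally show ?thesis using False by (simp add: z1 z2 e v)
  qed
  \<comment> \<open>For m = 2 both quotients are 0, the first one through division by zero; for m =
    3 the graph is 2 K_2 and both are 1.\<close>
  moreover have "real (zagreb2 \<Gamma>) / real (card (edges \<Gamma>)) =
      real (zagreb1 \<Gamma>) / real (card (vertices \<Gamma>))" if "m = 2 \<or> m = 3"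
    using that by (auto simp: z1 z2 e v k_def)
  ultimately show ?thesis
    by (simp add: z1 z2) (simp add: k_def)
qed

end
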